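(* Let $n\ge 1$ and let $\mathcal{G}$ be a finitely generated abelian semigroup of affine maps on $\mathbb{C}^n$, generated by $f_1,\dots,f_p$ ($p\ge 1$). Let $P\in\Phi(GA(n,\mathbb{C}))$ and $\eta=(n_1,\dots,n_r)$, a tuple of positive integers with $n_1+\dots+n_r=n+1$, be such that $P^{-1}\Phi(\mathcal{G})P\subset \mathcal{K}_{\eta,r}(\mathbb{C})$, and let $U=\varphi(U')\subset\mathbb{C}^n$ be the associated open set, where $\varphi=\Phi^{-1}(P)$. If $J_{\mathcal{G}}(v)=\mathbb{C}^n$ for some $v\in U$, then $\overline{\mathcal{G}(v)}=\mathbb{C}^n$.
   Context: $MA(n,\mathbb{C})$ is the set of all affine maps $f=(A,a):\mathbb{C}^n\to\mathbb{C}^n$, $f(x)=Ax+a$, with $A\in M_n(\mathbb{C})$, $a\in\mathbb{C}^n$; it is a semigroup under composition. $GA(n,\mathbb{C})$ is the group of those with $A$ invertible. The injective multiplicative map $\Phi: MA(n,\mathbb{C})\to M_{n+1}(\mathbb{C})$ is $\Phi(A,a)=\begin{bmatrix} 1 & 0 \\ a & A \end{bmatrix}$. For $v\in\mathbb{C}^n$, $\mathcal{G}(v)=\{f(v): f\in\mathcal{G}\}$; the bar denotes closure. For $\mathcal{G}$ abelian and generated by $f_1,\dots,f_p$ and $x\in\mathbb{C}^n$, $J_{\mathcal{G}}(x)$ is the set of $y\in\mathbb{C}^n$ for which there exist a sequence $(x_m)_m$ in $\mathbb{C}^n$ with $x_m\to x$ and sequences of non-negative integers $(k_m^{(j)})_m$,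 $j=1,\dots,p$, with $k_m^{(1)}+\dots+k_m^{(p)}\to+\infty$, such that $f_1^{k_m^{(1)}}f_2^{k_m^{(2)}}\cdots f_p^{k_m^{(p)}}(x_m)\to y$ (powers are iterates, products are compositions, and $f^0$ is the identity). For $m\ge1$, $\mathbb{T}_m(\mathbb{C})$ is the set of lower triangular $m\times m$ complex matrices all of whose diagonal entries are equal to one another. For a tuple $\eta=(n_1,\dots,n_r)$ of positive integers with sum $n+1$, $\mathcal{K}_{\eta,r}(\mathbb{C})=\mathbb{T}_{n_1}(\mathbb{C})\oplus\dots\oplus\mathbb{T}_{n_r}(\mathbb{C})$ is the set of block diagonal matrices in $M_{n+1}(\mathbb{C})$ with $k$-th diagonal block in $\mathbb{T}_{n_k}(\mathbb{C})$. For every abelian sub-semigroup $\mathcal{G}$ of $MA(n,\mathbb{C})$ a pair $(P,\eta)$ as in the claim exists. Let $\mathbb{C}^*=\mathbb{C}\setminus\{0\}$. The set $U'\subset\mathbb{C}^n$ is $U'=\mathbb{C}^{n_1-1}\times\prod_{k=2}^{r}(\mathbb{C}^*\times\mathbb{C}^{n_k-1})$ if $r\ge2$, and $U'=\mathbb{C}^{n_1-1}=\mathbb{C}^n$ if $r=1$. Writing $P=\begin{bmatrix} 1 & 0 \\ d & Q \end{bmatrix}$ with $Q\in GL(n,\mathbb{C})$, one has $\varphi=(Q,d)$, i.e. $\varphi(x)=Qx+d$. *)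

theory Defs
  imports "HOL-Analysis.Analysis" "HOL-Library.Option_ord"
begin

text \<open>
  \<open>\<complex>\<^sup>n\<close> is \<open>complex ^ 'n\<close> with \<open>n = CARD('n)\<close>; its coordinates are ordered by the linear order
  on \<open>'n\<close>. Matrices of size \<open>n + 1\<close> are indexed by \<open>'n option\<close>, whose least element \<open>None\<close>
  is the index of the additional first row and column. All positions are counted from 0.
\<close>

definition coord :: "nat \<Rightarrow> 'm::{finite,linorder}" where
  "coord k = sorted_list_of_set UNIV ! k"

definition affine_map :: "complex^'n^'n \<Rightarrow> complex^'n \<Rightarrow> complex^'n \<Rightarrow> complex^'n" where
  "affine_map A a = (\<lambda>x. A *v x + a)"

definition MA :: "(complex^'n \<Rightarrow> complex^'n) set" where
  "MA = {affine_map A a | A a. True}"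

definition Phi :: "complex^'n^'n \<Rightarrow> complex^'n \<Rightarrow> complex^('n option)^('n option)" where
  "Phi A a = (\<chi> i j. case (i, j) of
      (None, None) \<Rightarrow> 1
    | (None, Some j') \<Rightarrow> 0
    | (Some i', None) \<Rightarrow> a $ i'
    | (Some i', Some j') \<Rightarrow> A $ i' $ j')"

definition Phi_set :: "(complex^'n \<Rightarrow> complex^'n) set \<Rightarrow> (complex^('n option)^('n option)) set" where
  "Phi_set G = {Phi A a | A a. affine_map A a \<in> G}"

inductive_set generated_semigroup :: "('a \<Rightarrow> 'a) set \<Rightarrow> ('a \<Rightarrow> 'a) set"
  for S :: "('a \<Rightarrow> 'a) set" where
  generator: "f \<in> S \<Longrightarrow> f \<in> generated_semigroup S"
| compose: "f \<in> generated_semigroup S \<Longrightarrow> g \<in> generated_semigroup S \<Longrightarrow>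
    f \<circ> g \<in> generated_semigroup S"

definition abelian :: "('a \<Rightarrow> 'a) set \<Rightarrow> bool" where
  "abelian G \<longleftrightarrow> (\<forall>f\<in>G. \<forall>g\<in>G. f \<circ> g = g \<circ> f)"

definition orbit :: "('a \<Rightarrow> 'a) set \<Rightarrow> 'a \<Rightarrow> 'a set" where
  "orbit G v = {f v | f. f \<in> G}"

text \<open>The composition \<open>f\<^sub>1\<^bsup>k 1\<^esup> \<circ> \<dots> \<circ> f\<^sub>p\<^bsup>k p\<^esup>\<close>.\<close>

definition power_word :: "nat \<Rightarrow> (nat \<Rightarrow> 'a \<Rightarrow> 'a) \<Rightarrow> (nat \<Rightarrow> nat) \<Rightarrow> 'a \<Rightarrow> 'a" where
  "power_word p f k = foldr (\<circ>) (map (\<lambda>j. f j ^^ k j) [1..<Suc p]) id"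

text \<open>The set \<open>J\<^sub>G(x)\<close>, taken with respect to the generators \<open>f\<^sub>1, \<dots>, f\<^sub>p\<close> of \<open>G\<close>.\<close>

definition J_set :: "nat \<Rightarrow> (nat \<Rightarrow> 'a \<Rightarrow> 'a) \<Rightarrow> 'a::topological_space \<Rightarrow> 'a set" where
  "J_set p f x = {y. \<exists>(xs :: nat \<Rightarrow> 'a) (k :: nat \<Rightarrow> nat \<Rightarrow> nat).
      xs \<longlonglongrightarrow> x \<and>
      filterlim (\<lambda>m. \<Sum>j=1..p. k m j) at_top sequentially \<and>
      (\<lambda>m. power_word p f (k m) (xs m)) \<longlonglongrightarrow> y}"

text \<open>Membership in \<open>\<T>\<^sub>m(\<complex>)\<close> depends only on the entries with both indices below \<open>m\<close>.\<close>

definition T_matrices :: "nat \<Rightarrow> (nat \<Rightarrow> nat \<Rightarrow> complex) set" where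
  "T_matrices m = {B. (\<forall>a<m. \<forall>b<m. a < b \<longrightarrow> B a b = 0) \<and> (\<forall>a<m. \<forall>b<m. B a a = B b b)}"

text \<open>The position of the first index of the block \<open>k\<close>.\<close>

definition block_start :: "nat list \<Rightarrow> nat \<Rightarrow> nat" where
  "block_start \<eta> k = sum_list (take k \<eta>)"

text \<open>The entries of the \<open>(k, l)\<close> block of \<open>M\<close>, which has size \<open>\<eta> ! k\<close> by \<open>\<eta> ! l\<close>.\<close>

definition block ::
    "nat list \<Rightarrow> complex^'m::{finite,linorder}^'m::{finite,linorder} \<Rightarrow> nat \<Rightarrow> nat \<Rightarrow> nat \<Rightarrow> nat \<Rightarrow> complex" where
  "block \<eta> M k l = (\<lambda>a b. M $ coord (block_start \<eta> k + a)
                            $ coord (block_start \<eta> l + b))"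

definition K_matrices :: "nat list \<Rightarrow> (complex^'m::{finite,linorder}^'m::{finite,linorder}) set" where
  "K_matrices \<eta> = {M.
      (\<forall>k<length \<eta>. block \<eta> M k k \<in> T_matrices (\<eta> ! k)) \<and>
      (\<forall>k<length \<eta>. \<forall>l<length \<eta>. k \<noteq> l \<longrightarrow>
        (\<forall>a<\<eta> ! k. \<forall>b<\<eta> ! l. block \<eta> M k l a b = 0))}"

text \<open>
  The factors \<open>\<complex>\<^sup>*\<close> of \<open>U'\<close> are the first coordinates of all blocks but the first. As \<open>\<complex>\<^sup>n\<close>
  lacks the leading coordinate of \<open>\<complex>\<^sup>n\<^sup>+\<^sup>1\<close>, positions are shifted by one.
\<close>

definition U' :: "nat list \<Rightarrow> (complex^'n::{finite,linorder}) set" where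
  "U' \<eta> = {x. \<forall>k. 1 \<le> k \<and> k < length \<eta> \<longrightarrow> x $ coord (block_start \<eta> k - 1) \<noteq> 0}"

end

theory Submission
  imports Defs
begin

text \<open>
  Passing to \<open>\<complex>\<^sup>n\<^sup>+\<^sup>1\<close> by \<open>x \<mapsto> (1, x)\<close> and conjugating by \<open>P\<close>, the semigroup becomes a commuting
  set \<open>S\<close> of matrices, closed under products, that are block diagonal with lower triangular
  blocks, each with a single diagonal entry. The point \<open>v\<close> becomes a vector \<open>w\<close> whose leading
  coordinate in every block is nonzero: it is 1 in the first block, and for the other blocks this
  is what \<open>v \<in> U\<close> says. By hypothesis each point \<open>y\<close> of the affine hyperplane that corresponds
  to \<open>\<complex>\<^sup>n\<close> is a limit of vectors \<open>M\<^sub>m x\<^sub>m\<close> with \<open>M\<^sub>m \<in> S\<close> and \<open>x\<^sub>m \<rightarrow> w\<close>, and \<open>x\<^sub>m\<close> must be replaced by \<open>w\<close>.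

  The first step is that \<open>w\<close> and the vectors \<open>M w\<close> span the whole space (\<open>cyclic_of_limits\<close>). If
  not, the functionals that vanish on them form a nonzero \<open>S\<close>-invariant space, which by
  triangularity contains a common eigenfunctional \<open>\<phi>\<close> whose eigenvalue under each \<open>M\<close> is the
  diagonal entry of \<open>M\<close> in one and the same block. The leading coordinate of that block is an
  eigenfunctional with the same eigenvalues, so the quotient of \<open>\<phi>\<close> by it takes the same value at
  \<open>x\<^sub>m\<close> and, where it is defined, at \<open>M\<^sub>m x\<^sub>m\<close>. At \<open>x\<^sub>m\<close> it tends to 0, since \<open>\<phi> w = 0\<close> while the leading coordinate of \<open>w\<close>
  is nonzero; hence \<open>\<phi> y = 0\<close> for every \<open>y\<close> in the hyperplane. The hyperplane spans, so \<open>\<phi> = 0\<close>, a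
  contradiction.

  The second step (\<open>orbit_limit_of_cyclic\<close>) uses that a cyclic vector of a commutative algebra
  identifies the space with the algebra: every \<open>x\<close> is \<open>T x w\<close> for a matrix \<open>T x\<close> that depends
  linearly on \<open>x\<close> and commutes with \<open>S\<close>, and \<open>T w\<close> is the identity. So
  \<open>M\<^sub>m x\<^sub>m = M\<^sub>m (T x\<^sub>m w) = T x\<^sub>m (M\<^sub>m w)\<close> with \<open>T x\<^sub>m\<close> close to the identity, and \<open>M\<^sub>m w\<close> has the same
  limit \<open>y\<close>.
\<close>

section \<open>Functionals\<close>

definition pairing :: "complex^'m \<Rightarrow> complex^'m \<Rightarrow> complex" where
  "pairing \<phi> x = (\<Sum>i\<in>UNIV. \<phi> $ i * x $ i)"

lemma pairing_vector_matrix_mult: "pairing (\<phi> v* M) x = pairing \<phi> (M *v x)"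
  unfolding pairing_def vector_matrix_mult_def matrix_vector_mult_def
  by (simp add: sum_distrib_left sum_distrib_right mult_ac) (rule sum.swap)

lemma pairing_scale_left: "pairing (c *s \<phi>) x = c * pairing \<phi> x"
  by (simp add: pairing_def sum_distrib_left mult_ac)

lemma pairing_diff_left: "pairing (\<phi> - \<psi>) x = pairing \<phi> x - pairing \<psi> x"
  by (simp add: pairing_def sum_subtractf algebra_simps)

lemma tendsto_pairing:
  "(x \<longlongrightarrow> y) F \<Longrightarrow> ((\<lambda>m. pairing \<phi> (x m)) \<longlongrightarrow> pairing \<phi> y) F"
  unfolding pairing_def by (intro tendsto_intros)

lemma pairing_zero_imp_zero:
  assumes "vec.span Y = UNIV" "\<And>y. y \<in> Y \<Longrightarrow> pairing \<phi> y = 0"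
  shows "\<phi> = 0"
proof -
  have "pairing \<phi> x = 0" for x
  proof -
    have "x \<in> vec.span Y" using assms(1) by simp
    then show ?thesis
    proof (induction rule: vec.span_induct_alt)
      case base
      then show ?case by (simp add: pairing_def)
    next
      case (step c x y)
      then show ?case using assms(2)[of x]
        by (simp add: pairing_def algebra_simps sum.distrib flip: sum_distrib_left)
    qed
  qed
  from this[of "axis i 1" for i] show ?thesis
    by (simp add: pairing_def vec_eq_iff axis_def if_distrib cong: if_cong)
qed

text \<open>
  The witness is a coordinate functional of a basis of the space that extends a basis of the span
  of \<open>X\<close>.
\<close>

lemma exists_annihilator:
  fixes X :: "(complex^'m) set"
  assumes "vec.span X \<noteq> UNIV"
  obtains \<phi> where "\<phi> \<noteq> 0" "\<And>x. x \<in> X \<Longrightarrow> pairing \<phi> x = 0"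
proof -
  obtain B where B: "B \<subseteq> X" "vec.independent B" "X \<subseteq> vec.span B"
    using vec.maximal_independent_subset by blast
  define E where "E = vec.extend_basis B"
  have E: "B \<subseteq> E" "vec.independent E" "vec.span E = UNIV"
    using B(2) by (auto simp: E_def vec.extend_basis_superset vec.independent_extend_basis)
  have "vec.span B \<noteq> UNIV"
    using assms B by (metis vec.span_eq vec.span_superset order_trans)
  with E obtain b where b: "b \<in> E" "b \<notin> B" by (metis subset_antisym subsetI)
  define h where "h x = vec.representation E x b" for x
  have h_add: "h (x + y) = h x + h y" for x y
    by (simp add: h_def vec.representation_add E)
  have h_scale: "h (c *s x) = c * h x" for c x
    by (simp add: h_def vec.representation_scale E)
  have h_0: "h 0 = 0"
    by (simp add: h_def vec.representation_zero)
  have h_sum: "h (sum g A) = (\<Sum>a\<in>A. h (g a))" if "finite A" for g A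
    using that by induction (auto simp: h_add h_0)
  define \<phi> where "\<phi> = (\<chi> i. h (axis i 1))"
  have \<phi>: "pairing \<phi> x = h x" for x
  proof -
    have "h x = h (\<Sum>i\<in>UNIV. x $ i *s axis i 1)" by (simp add: basis_expansion)
    then show ?thesis by (simp add: pairing_def \<phi>_def h_sum h_scale mult.commute)
  qed
  show thesis
  proof
    have "pairing \<phi> b = 1" using b by (simp add: \<phi> h_def vec.representation_basis E)
    then show "\<phi> \<noteq> 0" by (auto simp: pairing_def)
    have 0: "pairing \<phi> x = 0" if "x \<in> B" for x
      using that b E(1) by (auto simp: \<phi> h_def vec.representation_basis[OF E(2)])
    fix x assume "x \<in> X"
    with B have "x \<in> vec.span B" by auto
    then show "pairing \<phi> x = 0"
      by (induction rule: vec.span_induct_alt) (simp_all add: \<phi> h_add h_scale h_0 0[unfolded \<phi>])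
  qed
qed

section \<open>Block triangular matrices and their eigenfunctionals\<close>

text \<open>
  The partition of the indices into blocks is encoded by the map \<open>ld\<close> that sends an index to the
  first index of its block.
\<close>

definition block_triangular :: "('m \<Rightarrow> 'm) \<Rightarrow> complex^'m::{finite,linorder}^'m::{finite,linorder} \<Rightarrow> bool" where
  "block_triangular ld M \<longleftrightarrow>
    (\<forall>i j. ld i \<noteq> ld j \<or> i < j \<longrightarrow> M $ i $ j = 0) \<and> (\<forall>i. M $ i $ i = M $ ld i $ ld i)"

lemma block_triangular_zero:
  "block_triangular ld M \<Longrightarrow> ld i \<noteq> ld j \<or> i < j \<Longrightarrow> M $ i $ j = 0"
  unfolding block_triangular_def by blast

lemma block_triangular_diagonal: "block_triangular ld M \<Longrightarrow> M $ i $ i = M $ ld i $ ld i"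
  unfolding block_triangular_def by blast

text \<open>
  On row vectors supported in the block of \<open>k\<close>, a block triangular matrix minus its entry at
  \<open>(k, k)\<close> pushes the last nonzero entry to a strictly smaller index, and it does not raise the
  last nonzero entry in any other block. So a nonzero element of \<open>W\<close> whose last nonzero entries
  lie as low as possible must be killed by this operator for every \<open>M\<close> at once, where \<open>k\<close> is the
  start of any block in which the element does not vanish.
\<close>

lemma common_eigenfunctional:
  fixes S :: "(complex^'m::{finite,linorder}^'m::{finite,linorder}) set" and \<phi> :: "complex^'m::{finite,linorder}"
  assumes S: "\<And>M. M \<in> S \<Longrightarrow> block_triangular ld M"
    and idem: "\<And>i. ld (ld i) = ld i"
    and W: "\<And>\<phi> M c. \<phi> \<in> W \<Longrightarrow> M \<in> S \<Longrightarrow> \<phi> v* M - c *s \<phi> \<in> W"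
    and nz: "\<phi> \<in> W" "\<phi> \<noteq> 0"
  obtains \<psi> k where "\<psi> \<in> W" "\<psi> \<noteq> 0" "ld k = k" "\<And>M. M \<in> S \<Longrightarrow> \<psi> v* M = M $ k $ k *s \<psi>"
proof -
  \<comment> \<open>the indices that lie at or below the last nonzero entry of their block\<close>
  define D where "D \<phi> = {i. \<exists>j\<ge>i. ld j = ld i \<and> \<phi> $ j \<noteq> 0}" for \<phi> :: "complex^'m::{finite,linorder}"
  define \<psi> where "\<psi> = arg_min (\<lambda>\<phi>. card (D \<phi>)) (\<lambda>\<phi>. \<phi> \<in> W \<and> \<phi> \<noteq> 0)"
  note arg_min = arg_min_nat_lemma[of "\<lambda>\<phi>. \<phi> \<in> W \<and> \<phi> \<noteq> 0" \<phi> "\<lambda>\<phi>. card (D \<phi>)", folded \<psi>_def]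
  have \<psi>: "\<psi> \<in> W" "\<psi> \<noteq> 0"
    using arg_min nz by auto
  have min: "\<theta> = 0" if "\<theta> \<in> W" "card (D \<theta>) < card (D \<psi>)" for \<theta>
    using arg_min nz that by (auto simp: not_less)
  from \<psi> obtain j0 where j0: "\<psi> $ j0 \<noteq> 0" by (auto simp: vec_eq_iff)
  define k where "k = ld j0"
  have "\<psi> v* M = M $ k $ k *s \<psi>" if M: "M \<in> S" for M
  proof -
    define \<theta> where "\<theta> = \<psi> v* M - M $ k $ k *s \<psi>"
    have tri: "block_triangular ld M" using S M .
    have \<theta>_nth: "\<theta> $ j = (\<Sum>i\<in>UNIV. M $ i $ j * \<psi> $ i) - M $ k $ k * \<psi> $ j" for j
      by (simp add: \<theta>_def vector_matrix_mult_def mult.commute)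
    have sub: "D \<theta> \<subseteq> D \<psi>"
    proof
      fix i assume "i \<in> D \<theta>"
      then obtain j where j: "j \<ge> i" "ld j = ld i" "\<theta> $ j \<noteq> 0" by (auto simp: D_def)
      have "\<exists>l\<ge>j. ld l = ld j \<and> \<psi> $ l \<noteq> 0"
      proof (rule ccontr)
        assume *: "\<not> ?thesis"
        then have "M $ l $ j * \<psi> $ l = 0" for l
          using block_triangular_zero[OF tri, of l j] by (metis mult_eq_0_iff not_le)
        then have "(\<Sum>l\<in>UNIV. M $ l $ j * \<psi> $ l) = 0" by (intro sum.neutral ballI)
        moreover have "\<psi> $ j = 0" using * by blast
        ultimately show False using j(3) by (simp add: \<theta>_nth)
      qed
      then obtain l where "l \<ge> i" "ld l = ld i" "\<psi> $ l \<noteq> 0"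
        using j by (metis order_trans)
      then show "i \<in> D \<psi>" unfolding D_def by blast
    qed
    \<comment> \<open>The last nonzero entry of \<open>\<psi>\<close> in the block of \<open>k\<close> disappears, so the inclusion is strict.\<close>
    define t where "t = Max {j. ld j = k \<and> \<psi> $ j \<noteq> 0}"
    have t: "ld t = k" "\<psi> $ t \<noteq> 0"
      using Max_in[of "{j. ld j = k \<and> \<psi> $ j \<noteq> 0}"] j0 by (auto simp: t_def k_def)
    have t_max: "j \<le> t" if "ld j = k" "\<psi> $ j \<noteq> 0" for j
      using that by (auto simp: t_def)
    have "\<theta> $ j = 0" if j: "t \<le> j" "ld j = k" for j
    proof -
      have "M $ i $ j * \<psi> $ i = (if i = j then M $ j $ j * \<psi> $ j else 0)" for i
      proof (cases "i = j \<or> M $ i $ j = 0")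
        case False
        then have "ld i = k" "j < i"
          using block_triangular_zero[OF tri, of i j] j(2) False by (metis linorder_neqE)+
        with t_max[of i] j have "\<psi> $ i = 0" by fastforce
        with False show ?thesis by simp
      qed auto
      then have "(\<Sum>i\<in>UNIV. M $ i $ j * \<psi> $ i) = (\<Sum>i\<in>UNIV. if i = j then M $ j $ j * \<psi> $ j else 0)"
        by (intro sum.cong refl)
      moreover have "M $ j $ j = M $ k $ k"
        using block_triangular_diagonal[OF tri, of j] j by simp
      ultimately show ?thesis by (simp add: \<theta>_nth)
    qed
    then have "t \<notin> D \<theta>" using t by (auto simp: D_def)
    moreover have "t \<in> D \<psi>" using t by (auto simp: D_def)
    ultimately have "card (D \<theta>) < card (D \<psi>)"
      using sub by (intro psubset_card_mono) auto
    moreover have "\<theta> \<in> W" unfolding \<theta>_def using W \<psi> M by blast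
    ultimately have "\<theta> = 0" using min by blast
    then show ?thesis by (simp add: \<theta>_def)
  qed
  with \<psi> idem show thesis by (intro that[of \<psi> k]) (auto simp: k_def)
qed

lemma leading_coordinate_matrix_vector_mult:
  assumes "block_triangular ld M" "\<And>i. ld i \<le> i" "ld k = k"
  shows "(M *v x) $ k = M $ k $ k * x $ k"
proof -
  have "M $ k $ j * x $ j = (if j = k then M $ k $ k * x $ k else 0)" for j
  proof (cases "j = k")
    case False
    then have "ld k \<noteq> ld j \<or> k < j" using assms(2)[of j] assms(3) by auto
    with block_triangular_zero[OF assms(1)] False show ?thesis by simp
  qed simp
  then have "(\<Sum>j\<in>UNIV. M $ k $ j * x $ j) = (\<Sum>j\<in>UNIV. if j = k then M $ k $ k * x $ k else 0)"
    by (intro sum.cong refl)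
  then show ?thesis by (simp add: matrix_vector_mult_def)
qed

text \<open>
  The functional \<open>\<phi>\<close> and the coordinate at the first index \<open>k\<close> of a block are scaled by the same
  factor, so their quotient has the same value at \<open>x m\<close> and at \<open>M m *v x m\<close>. The proof clears
  denominators, as the factor may be 0.
\<close>

lemma eigenfunctional_vanishes_on_limits:
  assumes lim: "x \<longlonglongrightarrow> w" "(\<lambda>m. M m *v x m) \<longlonglongrightarrow> y"
    and M: "\<And>m. block_triangular ld (M m)" "\<And>m. \<phi> v* M m = M m $ k $ k *s \<phi>"
    and ld: "\<And>i. ld i \<le> i" "ld k = k"
    and w: "pairing \<phi> w = 0" "w $ k \<noteq> 0"
  shows "pairing \<phi> y = 0"
proof -
  have "pairing \<phi> (M m *v x m) * x m $ k = (M m *v x m) $ k * pairing \<phi> (x m)" for m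
    using leading_coordinate_matrix_vector_mult[OF M(1) ld] M(2)
    by (simp add: pairing_scale_left flip: pairing_vector_matrix_mult)
  moreover have "(\<lambda>m. pairing \<phi> (M m *v x m) * x m $ k) \<longlonglongrightarrow> pairing \<phi> y * w $ k"
    by (intro tendsto_intros tendsto_pairing lim)
  moreover have "(\<lambda>m. (M m *v x m) $ k * pairing \<phi> (x m)) \<longlonglongrightarrow> y $ k * pairing \<phi> w"
    by (intro tendsto_intros tendsto_pairing lim)
  ultimately show ?thesis using w LIMSEQ_unique by fastforce
qed

section \<open>Cyclic vectors\<close>

text \<open>
  An eigenfunctional that vanishes at \<open>w\<close> would vanish on all of \<open>Y\<close>, and invariance produces
  such an eigenfunctional as soon as any functional vanishes on the orbit of \<open>w\<close>.
\<close>

lemma cyclic_of_limits: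
  fixes S :: "(complex^'m::{finite,linorder}^'m::{finite,linorder}) set"
  assumes S: "\<And>M. M \<in> S \<Longrightarrow> block_triangular ld M"
    and closed: "\<And>M N. M \<in> S \<Longrightarrow> N \<in> S \<Longrightarrow> M ** N \<in> S"
    and ld: "\<And>i. ld i \<le> i" "\<And>i. ld (ld i) = ld i"
    and w: "\<And>i. w $ ld i \<noteq> 0"
    and Y: "vec.span Y = UNIV"
    and lim: "\<And>y. y \<in> Y \<Longrightarrow> \<exists>x M. range M \<subseteq> S \<and> x \<longlonglongrightarrow> w \<and> (\<lambda>m. M m *v x m) \<longlonglongrightarrow> y"
  shows "vec.span (insert w ((\<lambda>M. M *v w) ` S)) = UNIV"
proof (rule ccontr)
  let ?X = "insert w ((\<lambda>M. M *v w) ` S)"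
  assume "vec.span ?X \<noteq> UNIV"
  then obtain \<phi> where \<phi>: "\<phi> \<noteq> 0" "\<And>x. x \<in> ?X \<Longrightarrow> pairing \<phi> x = 0"
    using exists_annihilator by blast
  define W where "W = {\<phi>. \<forall>x\<in>?X. pairing \<phi> x = 0}"
  have W: "\<phi> v* M - c *s \<phi> \<in> W" if "\<phi> \<in> W" "M \<in> S" for \<phi> M c
    using that closed
    by (auto simp: W_def pairing_diff_left pairing_scale_left pairing_vector_matrix_mult
        matrix_vector_mul_assoc)
  obtain \<psi> k where \<psi>: "\<psi> \<in> W" "\<psi> \<noteq> 0" "ld k = k" "\<And>M. M \<in> S \<Longrightarrow> \<psi> v* M = M $ k $ k *s \<psi>"
    using common_eigenfunctional[of S ld W \<phi>] S ld(2) W \<phi> by (auto simp: W_def)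
  have "pairing \<psi> y = 0" if y: "y \<in> Y" for y
  proof -
    obtain x M where xM: "range M \<subseteq> S" "x \<longlonglongrightarrow> w" "(\<lambda>m. M m *v x m) \<longlonglongrightarrow> y"
      using lim[OF y] by blast
    have M: "M m \<in> S" for m using xM(1) by blast
    show ?thesis
    proof (rule eigenfunctional_vanishes_on_limits[OF xM(2,3) S[OF M] \<psi>(4)[OF M] ld(1) \<psi>(3)])
      show "pairing \<psi> w = 0" using \<psi>(1) by (simp add: W_def)
      show "w $ k \<noteq> 0" using w[of k] \<psi>(3) by simp
    qed
  qed
  with Y \<psi>(2) show False using pairing_zero_imp_zero by blast
qed

text \<open>
  Since \<open>w\<close> is cyclic, a basis can be chosen among the vectors \<open>C b *v w\<close> with \<open>C b\<close> in \<open>S\<close> or the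
  identity, and \<open>T x\<close> is the combination of the \<open>C b\<close> with the coordinates of \<open>x\<close>. The sequence
  \<open>M m *v w\<close> is not known to be bounded in advance; its bound comes from \<open>T (x m)\<close> being close to
  the identity.
\<close>

lemma orbit_limit_of_cyclic:
  fixes S :: "(complex^'m^'m) set"
  assumes comm: "\<And>M N. M \<in> S \<Longrightarrow> N \<in> S \<Longrightarrow> M ** N = N ** M"
    and span: "vec.span (insert w ((\<lambda>M. M *v w) ` S)) = UNIV"
    and M: "\<And>m. M m \<in> S"
    and lim: "x \<longlonglongrightarrow> w" "(\<lambda>m. M m *v x m) \<longlonglongrightarrow> y"
  shows "(\<lambda>m. M m *v w) \<longlonglongrightarrow> y"
proof -
  let ?X = "(\<lambda>M. M *v w) ` insert (mat 1) S"
  obtain B where B: "B \<subseteq> ?X" "vec.independent B" "?X \<subseteq> vec.span B"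
    using vec.maximal_independent_subset by blast
  have spanB: "vec.span B = UNIV"
    using B span vec.span_mono[OF B(3)] by (auto simp: vec.span_span)
  have finB: "finite B" using B(2) vec.finiteI_independent by blast
  obtain C where C: "\<And>b. b \<in> B \<Longrightarrow> C b \<in> insert (mat 1) S \<and> C b *v w = b"
    using B(1) by (metis (no_types, lifting) image_iff subset_iff)
  define T where "T u z = (\<Sum>b\<in>B. vec.representation B u b *s (C b *v z))" for u z
  have T_w: "T u w = u" for u
    using vec.sum_representation_eq[OF B(2) _ finB, of u] spanB
    by (simp add: T_def C)
  have T_add: "T (u + u') z = T u z + T u' z" for u u' z
    by (simp add: T_def vec.representation_add[OF B(2)] spanB sum.distrib
        vec.scale_left_distrib)
  have T_scale: "T (c *s u) z = c *s T u z" for c u z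
    by (simp add: T_def vec.representation_scale[OF B(2)] spanB vec.scale_sum_right)
  have T_add': "T u (z + z') = T u z + T u z'" for u z z'
    by (simp add: T_def matrix_vector_right_distrib vec.scale_right_distrib sum.distrib)
  have T_scale': "T u (c *s z) = c *s T u z" for c u z
    by (simp add: T_def vec.scale_sum_right vector_scalar_commute mult.commute)
  have T_comm: "N *v T u z = T u (N *v z)" if "N \<in> S" for N u z
  proof -
    have "N *v (c *s (C b *v z)) = c *s (C b *v (N *v z))" if "b \<in> B" for c b
      using C[OF that] comm[OF \<open>N \<in> S\<close>]
      by (auto simp: vector_scalar_commute matrix_vector_mul_assoc)
    then show ?thesis by (simp add: T_def linear_sum[OF matrix_vector_mul_linear])
  qed
  have T_id: "T w z = z" for z
  proof -
    have "z \<in> vec.span B" using spanB by simp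
    then show ?thesis
    proof (induction rule: vec.span_induct_alt)
      case base
      then show ?case by (simp add: T_def)
    next
      case (step c b z)
      then have "T w b = b"
        using C[of b] T_comm[of "C b" w w] T_w[of w] by auto
      with step show ?case by (simp add: T_add' T_scale')
    qed
  qed
  have scaleR: "r *\<^sub>R u = complex_of_real r *s u" for r and u :: "complex^'m"
    by (simp add: vec_eq_iff scaleR_conv_of_real[where 'a=complex])
  have "bilinear T"
    unfolding bilinear_def linear_iff by (auto simp: T_add T_add' scaleR T_scale T_scale')
  then have "bounded_bilinear T" by (simp add: bilinear_conv_bounded_bilinear)
  then interpret bounded_bilinear T .
  \<comment> \<open>\<open>u m = T (x m) (z m)\<close> and \<open>z m = T w (z m)\<close>, so \<open>z m - u m\<close> is small relative to \<open>z m\<close>.\<close>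
  define z where "z m = M m *v w" for m
  define u where "u m = M m *v x m" for m
  have u: "u m = T (x m) (z m)" for m
    using T_comm[OF M, of m "x m" w] by (simp add: u_def z_def T_w)
  obtain K where K: "K > 0" "\<And>a b. norm (T a b) \<le> norm a * norm b * K"
    using pos_bounded by blast
  have diff: "norm (z m - u m) \<le> norm (w - x m) * K * norm (z m)" for m
  proof -
    have "z m - u m = T (w - x m) (z m)" by (simp only: u diff_left T_id)
    then show ?thesis using K(2)[of "w - x m" "z m"] by (metis mult.assoc mult.commute)
  qed
  have e: "(\<lambda>m. norm (w - x m) * K) \<longlonglongrightarrow> 0"
    using tendsto_mult_left[OF tendsto_norm[OF tendsto_diff[OF tendsto_const lim(1)]], of K w]
    by (simp add: mult.commute)
  have "\<forall>\<^sub>F m in sequentially. norm (w - x m) * K < 1/2"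
    using order_tendstoD(2)[OF e, of "1/2"] by simp
  then have "\<forall>\<^sub>F m in sequentially. norm (z m - u m) \<le> norm (w - x m) * K * (2 * norm (u m))"
  proof eventually_elim
    case (elim m)
    have "norm (z m) \<le> norm (u m) + norm (z m - u m)"
      by (metis norm_triangle_sub)
    also have "\<dots> \<le> norm (u m) + 1/2 * norm (z m)"
      using diff[of m] mult_right_mono[of "norm (w - x m) * K" "1/2" "norm (z m)"] elim by simp
    finally have "norm (z m) \<le> 2 * norm (u m)" by simp
    then show ?case using diff[of m] K(1)
      by (smt (verit) mult_left_mono norm_ge_zero mult_nonneg_nonneg)
  qed
  moreover have "(\<lambda>m. norm (w - x m) * K * (2 * norm (u m))) \<longlonglongrightarrow> 0 * (2 * norm y)"
    unfolding u_def by (intro tendsto_intros e lim)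
  ultimately have "(\<lambda>m. z m - u m) \<longlonglongrightarrow> 0"
    by (intro Lim_null_comparison[of "\<lambda>m. z m - u m"]) auto
  from tendsto_add[OF this lim(2)[folded u_def]] show ?thesis by (simp add: z_def)
qed


section \<open>The block structure of the matrices in \<open>\<K>\<^sub>\<eta>\<close>\<close>

fun block_of :: "nat list \<Rightarrow> nat \<Rightarrow> nat" where
  "block_of [] t = 0"
| "block_of (m # \<eta>) t = (if t < m then 0 else Suc (block_of \<eta> (t - m)))"

lemma block_of_block_start:
  "k < length \<eta> \<Longrightarrow> a < \<eta> ! k \<Longrightarrow> block_of \<eta> (block_start \<eta> k + a) = k"
  by (induction \<eta> arbitrary: k) (auto simp: block_start_def nth_Cons take_Cons split: nat.splits)

lemma position_in_block:
  assumes "t < sum_list \<eta>"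
  obtains k a where "k < length \<eta>" "a < \<eta> ! k" "t = block_start \<eta> k + a"
  using assms
proof (induction \<eta> arbitrary: t thesis)
  case (Cons m \<eta>)
  show ?case
  proof (cases "t < m")
    case True
    then show ?thesis using Cons.prems(1)[of 0 t] by (simp add: block_start_def)
  next
    case False
    with Cons.prems(2) have "t - m < sum_list \<eta>" by simp
    with Cons.IH obtain k a where "k < length \<eta>" "a < \<eta> ! k" "t - m = block_start \<eta> k + a"
      by blast
    with False show ?thesis using Cons.prems(1)[of "Suc k" a] by (simp add: block_start_def)
  qed
qed simp

lemma strict_mono_on_coord: "strict_mono_on {..<CARD('m)} (coord :: nat \<Rightarrow> 'm::{finite,linorder})"
  unfolding coord_def
  by (intro strict_mono_onI) (auto simp: sorted_wrt_iff_nth_less dest: sorted_wrt_nth_less[OF strict_sorted_list_of_set])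

lemma coord_surj:
  fixes i :: "'m::{finite,linorder}"
  obtains t where "t < CARD('m)" "i = coord t"
proof -
  have "i \<in> set (sorted_list_of_set UNIV)" by simp
  with that show thesis unfolding in_set_conv_nth coord_def by auto
qed

lemma sorted_list_of_set_option:
  "sorted_list_of_set (UNIV :: 'n::{finite,linorder} option set) =
    None # map Some (sorted_list_of_set UNIV)"
proof (rule sorted_distinct_set_unique)
  show "sorted (None # map Some (sorted_list_of_set (UNIV :: 'n set)))"
    by (simp add: sorted_wrt_map)
  show "distinct (None # map Some (sorted_list_of_set (UNIV :: 'n set)))"
    by (simp add: distinct_map)
  have "set (sorted_list_of_set (UNIV :: 'n option set)) = UNIV"
    by (rule set_sorted_list_of_set) simp
  then show "set (sorted_list_of_set (UNIV :: 'n option set)) =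
      set (None # map Some (sorted_list_of_set UNIV))"
    by (simp add: UNIV_option_conv)
qed simp_all

lemma coord_option_0: "coord 0 = (None :: 'n::{finite,linorder} option)"
  by (simp add: coord_def sorted_list_of_set_option)

lemma coord_option_Suc:
  "t < CARD('n) \<Longrightarrow> coord (Suc t) = Some (coord t :: 'n::{finite,linorder})"
  by (simp add: coord_def sorted_list_of_set_option)

text \<open>The first index of the block of \<open>i\<close>; \<open>inv_into\<close> recovers the position of \<open>i\<close>.\<close>

definition leader :: "nat list \<Rightarrow> 'm::{finite,linorder} \<Rightarrow> 'm" where
  "leader \<eta> i = coord (block_start \<eta> (block_of \<eta> (inv_into {..<CARD('m)} coord i)))"

lemma leader_coord:
  assumes "sum_list \<eta> = CARD('m)" "k < length \<eta>" "a < \<eta> ! k"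
  shows "block_start \<eta> k + a < CARD('m)"
    and "leader \<eta> (coord (block_start \<eta> k + a) :: 'm::{finite,linorder}) = coord (block_start \<eta> k)"
proof -
  have "sum_list \<eta> = sum_list (take k \<eta>) + \<eta> ! k + sum_list (drop (Suc k) \<eta>)"
    using arg_cong[OF id_take_nth_drop[OF assms(2)], of sum_list] by simp
  with assms show *: "block_start \<eta> k + a < CARD('m)" by (simp add: block_start_def)
  then show "leader \<eta> (coord (block_start \<eta> k + a) :: 'm) = coord (block_start \<eta> k)"
    using strict_mono_on_imp_inj_on[OF strict_mono_on_coord[where 'm='m]] assms
    by (simp add: leader_def inv_into_f_f block_of_block_start)
qed

lemma leader_cases:
  fixes i :: "'m::{finite,linorder}"
  assumes "sum_list \<eta> = CARD('m)"
  obtains k a where "k < length \<eta>" "a < \<eta> ! k" "i = coord (block_start \<eta> k + a)"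
    "leader \<eta> i = coord (block_start \<eta> k)"
  using coord_surj[of i] position_in_block[of _ \<eta>] leader_coord(2)[OF assms] assms by metis

lemma coord_less_iff:
  "s < CARD('m) \<Longrightarrow> t < CARD('m) \<Longrightarrow> (coord s :: 'm::{finite,linorder}) < coord t \<longleftrightarrow> s < t"
  using strict_mono_on_less[OF strict_mono_on_coord[where 'm='m]] by auto

lemma leader_le:
  fixes i :: "'m::{finite,linorder}"
  assumes "sum_list \<eta> = CARD('m)"
  shows "leader \<eta> i \<le> i"
proof -
  obtain k a where ka: "k < length \<eta>" "a < \<eta> ! k" "i = coord (block_start \<eta> k + a)"
    "leader \<eta> i = coord (block_start \<eta> k)"
    using leader_cases[OF assms] .
  moreover have "block_start \<eta> k + a < CARD('m)" using leader_coord(1)[OF assms ka(1,2)] .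
  ultimately show ?thesis
    using coord_less_iff[of "block_start \<eta> k + a" "block_start \<eta> k", where 'm='m]
    by (simp add: not_less[symmetric] del: not_less)
qed

lemma leader_idem:
  fixes i :: "'m::{finite,linorder}"
  assumes "sum_list \<eta> = CARD('m)"
  shows "leader \<eta> (leader \<eta> i) = leader \<eta> i"
proof -
  obtain k a where ka: "k < length \<eta>" "a < \<eta> ! k" "leader \<eta> i = coord (block_start \<eta> k)"
    using leader_cases[OF assms] by metis
  then show ?thesis using leader_coord(2)[OF assms ka(1), of 0] by simp
qed

lemma K_matrices_block_triangular:
  fixes M :: "complex^'m::{finite,linorder}^'m::{finite,linorder}"
  assumes \<eta>: "sum_list \<eta> = CARD('m)" and M: "M \<in> K_matrices \<eta>"
  shows "block_triangular (leader \<eta>) M"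
proof -
  have "M $ i $ j = 0" if ij: "leader \<eta> i \<noteq> leader \<eta> j \<or> i < j" for i j
  proof -
    obtain k a where i: "k < length \<eta>" "a < \<eta> ! k" "i = coord (block_start \<eta> k + a)"
      "leader \<eta> i = coord (block_start \<eta> k)" using leader_cases[OF \<eta>] .
    obtain l b where j: "l < length \<eta>" "b < \<eta> ! l" "j = coord (block_start \<eta> l + b)"
      "leader \<eta> j = coord (block_start \<eta> l)" using leader_cases[OF \<eta>] .
    show ?thesis
    proof (cases "k = l")
      case True
      with ij i j have "a < b"
        using coord_less_iff[OF leader_coord(1)[OF \<eta> i(1,2)] leader_coord(1)[OF \<eta> j(1,2)]] by simp
      moreover have "block \<eta> M k k \<in> T_matrices (\<eta> ! k)"
        using M i by (simp add: K_matrices_def)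
      ultimately show ?thesis using i j True by (simp add: T_matrices_def block_def)
    next
      case False
      then have "block \<eta> M k l a b = 0" using M i j by (simp add: K_matrices_def)
      then show ?thesis using i j by (simp add: block_def)
    qed
  qed
  moreover have "M $ i $ i = M $ leader \<eta> i $ leader \<eta> i" for i
  proof -
    obtain k a where i: "k < length \<eta>" "a < \<eta> ! k" "i = coord (block_start \<eta> k + a)"
      "leader \<eta> i = coord (block_start \<eta> k)" using leader_cases[OF \<eta>] .
    have "block \<eta> M k k \<in> T_matrices (\<eta> ! k)"
      using M i(1) unfolding K_matrices_def by blast
    then have "block \<eta> M k k a a = block \<eta> M k k 0 0"
      using i(2) unfolding T_matrices_def by (metis (mono_tags, lifting) gr_zeroI less_nat_zero_code mem_Collect_eq)
    then show ?thesis using i by (simp add: block_def)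
  qed
  ultimately show ?thesis unfolding block_triangular_def by blast
qed

section \<open>Affine maps as matrices\<close>

definition lift :: "complex^'n \<Rightarrow> complex^('n option)" where
  "lift x = (\<chi> i. case i of None \<Rightarrow> 1 | Some j \<Rightarrow> x $ j)"

lemma lift_nth [simp]: "lift x $ None = 1" "lift x $ Some j = x $ j"
  by (simp_all add: lift_def)

lemma Phi_nth [simp]:
  "Phi A a $ None $ None = 1" "Phi A a $ None $ Some j = 0"
  "Phi A a $ Some i $ None = a $ i" "Phi A a $ Some i $ Some j = A $ i $ j"
  by (simp_all add: Phi_def)

lemma sum_option_UNIV: "sum g (UNIV :: 'n::finite option set) = g None + (\<Sum>j\<in>UNIV. g (Some j))"
  by (simp add: UNIV_option_conv sum.reindex)

lemma vec_option_eq_iff: "x = y \<longleftrightarrow> x $ None = y $ None \<and> (\<forall>j. x $ Some j = y $ Some j)"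
  by (simp add: vec_eq_iff split_option_all)

lemma Phi_mult_lift: "Phi A a *v lift x = lift (affine_map A a x)"
  by (simp add: vec_option_eq_iff matrix_vector_mult_def sum_option_UNIV affine_map_def)

lemma affine_map_comp: "affine_map A a \<circ> affine_map B b = affine_map (A ** B) (A *v b + a)"
  by (simp add: fun_eq_iff affine_map_def matrix_vector_mul_assoc matrix_vector_right_distrib)

lemma Phi_mult: "Phi A a ** Phi B b = Phi (A ** B) (A *v b + a)"
  by (simp add: vec_option_eq_iff matrix_matrix_mult_def matrix_vector_mult_def sum_option_UNIV)

lemma affine_map_inject: "affine_map A a = affine_map B b \<longleftrightarrow> A = B \<and> a = b"
proof
  assume eq: "affine_map A a = affine_map B b"
  then have ab: "a = b" by (metis affine_map_def add_0 matrix_vector_mult_0_right)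
  have "A *v x = B *v x" for x
    using fun_cong[OF eq, of x] ab by (simp add: affine_map_def)
  with ab show "A = B \<and> a = b" by (simp add: matrix_eq)
qed simp

lemma Phi_mat_1: "Phi (mat 1) 0 = mat 1"
  by (simp add: vec_option_eq_iff mat_def)

lemma matrix_inv_inverse:
  assumes "invertible A"
  shows "A ** matrix_inv A = mat 1" "matrix_inv A ** A = mat 1"
  using someI_ex[OF assms[unfolded invertible_def]] by (simp_all add: matrix_inv_def)

text \<open>The inverse is the matrix of the inverse affine map.\<close>

lemma invertible_Phi:
  assumes "invertible Q"
  shows "invertible (Phi Q d)"
proof -
  obtain R where R: "Q ** R = mat 1" "R ** Q = mat 1" using assms by (auto simp: invertible_def)
  have "Q *v (R *v (- d)) = - d" by (simp add: matrix_vector_mul_assoc R)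
  then have "Phi Q d ** Phi R (R *v (- d)) = mat 1"
    by (simp add: Phi_mult R flip: Phi_mat_1)
  moreover have "Phi R (R *v (- d)) ** Phi Q d = mat 1"
    by (simp add: Phi_mult R flip: Phi_mat_1 matrix_vector_right_distrib)
  ultimately show ?thesis unfolding invertible_def by blast
qed

text \<open>Although \<open>lift\<close> only reaches an affine hyperplane, this hyperplane avoids the origin.\<close>

lemma span_lift: "vec.span (range (lift :: complex^'n \<Rightarrow> _)) = UNIV"
proof -
  have "x \<in> vec.span (range lift)" for x :: "complex^('n option)"
  proof -
    define u where "u = (\<chi> j. x $ Some j)"
    have "x = x $ None *s lift 0 + (lift u - lift 0)"
      by (simp add: vec_option_eq_iff u_def)
    then show ?thesis
      by (metis vec.span_add vec.span_scale vec.span_diff vec.span_base rangeI)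
  qed
  then show ?thesis by blast
qed

lemma tendsto_lift: "(x \<longlongrightarrow> y) F \<Longrightarrow> ((\<lambda>m. lift (x m)) \<longlongrightarrow> lift y) F"
  unfolding lift_def by (intro tendsto_vec_lambda) (auto split: option.split intro: tendsto_vec_nth)

lemma tendsto_liftD:
  assumes "((\<lambda>m. lift (x m)) \<longlongrightarrow> lift y) F"
  shows "(x \<longlongrightarrow> y) F"
  using tendsto_vec_nth[OF assms, of "Some _"] by (intro vec_tendstoI) simp

lemma continuous_affine_map: "continuous_on UNIV (affine_map A a)"
  unfolding affine_map_def
  by (intro continuous_intros linear_continuous_on linear_linear[THEN iffD1] matrix_vector_mul_linear)

text \<open>
  The first block starts at the additional coordinate, where \<open>lift u\<close> is 1; the start of every
  later block is shifted by one when read in \<open>\<complex>\<^sup>n\<close>, as in the definition of \<open>U'\<close>.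
\<close>

lemma lift_leader_nonzero:
  fixes u :: "complex^'n::{finite,linorder}"
  assumes u: "u \<in> U' \<eta>" and pos: "\<And>m. m \<in> set \<eta> \<Longrightarrow> m > 0"
    and \<eta>: "sum_list \<eta> = CARD('n option)"
  shows "lift u $ leader \<eta> i \<noteq> 0"
proof -
  obtain k a where ka: "k < length \<eta>" "a < \<eta> ! k" "leader \<eta> i = coord (block_start \<eta> k)"
    using leader_cases[OF \<eta>, of i] by metis
  show ?thesis
  proof (cases "k = 0")
    case True
    then show ?thesis using ka by (simp add: block_start_def coord_option_0)
  next
    case False
    with ka have "\<eta> ! 0 \<in> set (take k \<eta>)"
      by (auto simp: in_set_conv_nth intro!: exI[of _ 0])
    moreover have "\<eta> ! 0 > 0"
      using ka pos[of "\<eta> ! 0"]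
      by (simp add: nth_mem length_greater_0_conv[symmetric] del: length_greater_0_conv)
    ultimately have "0 < block_start \<eta> k"
      unfolding block_start_def using member_le_sum_list by fastforce
    moreover have "block_start \<eta> k < CARD('n option)"
      using leader_coord(1)[OF \<eta> ka(1,2)] by simp
    ultimately have "coord (block_start \<eta> k) = Some (coord (block_start \<eta> k - 1) :: 'n)"
      using coord_option_Suc[of "block_start \<eta> k - 1", where 'n='n]
      by (simp add: UNIV_option_conv card_image card_insert_if)
    then show ?thesis using u ka False by (simp add: U'_def)
  qed
qed

section \<open>Words in the generators\<close>

lemma generated_semigroup_funpow:
  "g \<in> generated_semigroup S \<Longrightarrow> 0 < n \<Longrightarrow> g ^^ n \<in> generated_semigroup S"
proof (induction n)
  case (Suc n)
  then show ?case
    using generated_semigroup.compose[of g S "g ^^ n"] by (cases "n = 0") (auto simp: o_def)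
qed simp

text \<open>
  The identity need not belong to the semigroup, so at least one exponent has to be positive;
  the induction keeps track of whether this has happened yet.
\<close>

lemma power_word_in_generated_semigroup:
  assumes "0 < (\<Sum>j=1..p. k j)"
  shows "power_word p f k \<in> generated_semigroup (f ` {1..p})"
proof -
  let ?G = "generated_semigroup (f ` {1..p})"
  have "if \<exists>j\<in>set js. 0 < k j then foldr (\<circ>) (map (\<lambda>j. f j ^^ k j) js) id \<in> ?G
      else foldr (\<circ>) (map (\<lambda>j. f j ^^ k j) js) id = id"
    if "set js \<subseteq> {1..p}" for js
    using that
  proof (induction js)
    case (Cons j js)
    have "f j ^^ k j \<in> ?G" if "0 < k j"
      using Cons.prems that by (intro generated_semigroup_funpow generated_semigroup.generator) auto
    with Cons show ?case
      by (cases "k j = 0") (auto split: if_splits intro: generated_semigroup.compose)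
  qed simp
  moreover have "set [1..<Suc p] = {1..p}" by auto
  moreover have "\<exists>j\<in>{1..p}. 0 < k j" using assms by (metis gr_zeroI less_irrefl sum.neutral)
  ultimately show ?thesis unfolding power_word_def by (metis order_refl)
qed

text \<open>
  Only finitely many words of the sequence can be empty; dropping an initial segment leaves
  elements of the semigroup.
\<close>

lemma J_set_sequences:
  assumes "y \<in> J_set p f x"
  obtains g xs where "range g \<subseteq> generated_semigroup (f ` {1..p})"
    "xs \<longlonglongrightarrow> x" "(\<lambda>m. g m (xs m)) \<longlonglongrightarrow> y"
proof -
  obtain xs k where xs: "xs \<longlonglongrightarrow> x"
    and k: "filterlim (\<lambda>m. \<Sum>j=1..p. k m j) at_top sequentially"
    and lim: "(\<lambda>m. power_word p f (k m) (xs m)) \<longlonglongrightarrow> y"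
    using assms by (auto simp: J_set_def)
  obtain N where "\<And>m. m \<ge> N \<Longrightarrow> 0 < (\<Sum>j=1..p. k m j)"
    using k unfolding filterlim_at_top eventually_sequentially by (metis Suc_le_eq)
  then have "range (\<lambda>m. power_word p f (k (m + N))) \<subseteq> generated_semigroup (f ` {1..p})"
    by (intro image_subsetI power_word_in_generated_semigroup) simp
  then show thesis
    using LIMSEQ_ignore_initial_segment[OF xs, of N] LIMSEQ_ignore_initial_segment[OF lim, of N]
    by (rule that)
qed

section \<open>Density of the orbit\<close>

theorem theorem1p1:
  fixes p :: nat
    and f :: "nat \<Rightarrow> complex^'n::{finite,linorder} \<Rightarrow> complex^'n::{finite,linorder}"
    and G :: "(complex^'n::{finite,linorder} \<Rightarrow> complex^'n::{finite,linorder}) set"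
    and P :: "complex^('n::{finite,linorder} option)^('n::{finite,linorder} option)"
    and Q :: "complex^'n::{finite,linorder}^'n::{finite,linorder}"
    and d v :: "complex^'n::{finite,linorder}"
    and \<eta> :: "nat list"
    and U :: "(complex^'n::{finite,linorder}) set"
  assumes "p \<ge> 1"
    and "\<And>j. 1 \<le> j \<Longrightarrow> j \<le> p \<Longrightarrow> f j \<in> MA"
    and "G = generated_semigroup (f ` {1..p})"
    and "abelian G"
    and "invertible Q"
    and "P = Phi Q d"
    and "\<And>m. m \<in> set \<eta> \<Longrightarrow> m > 0"
    and "sum_list \<eta> = CARD('n) + 1"
    and "(\<lambda>M. matrix_inv P ** M ** P) ` Phi_set G \<subseteq> K_matrices \<eta>"
    and "U = affine_map Q d ` U' \<eta>"
    and "v \<in> U"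
    and "J_set p f v = UNIV"
  shows "closure (orbit G v) = UNIV"
proof -
  define S where "S = (\<lambda>M. matrix_inv P ** M ** P) ` Phi_set G"
  define q where "q x = matrix_inv Q *v (x - d)" for x
  have P: "P ** matrix_inv P = mat 1" "matrix_inv P ** P = mat 1"
    using matrix_inv_inverse[OF invertible_Phi[OF assms(5)]] assms(6) by simp_all
  have q: "q (affine_map Q d x) = x" "affine_map Q d (q x) = x" for x
    using matrix_inv_inverse[OF assms(5)] by (simp_all add: q_def affine_map_def matrix_vector_mul_assoc)
  have q_affine: "q = affine_map (matrix_inv Q) (- (matrix_inv Q *v d))"
    by (simp add: q_def affine_map_def fun_eq_iff matrix_vector_mult_diff_distrib)
  have P_lift: "P *v lift x = lift (affine_map Q d x)" for x
    using assms(6) by (simp add: Phi_mult_lift)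
  have P_inv_lift: "matrix_inv P *v lift x = lift (q x)" for x
  proof -
    have "matrix_inv P *v lift x = matrix_inv P *v (P *v lift (q x))" by (simp add: P_lift q)
    then show ?thesis by (simp add: matrix_vector_mul_assoc P)
  qed
  have \<eta>: "sum_list \<eta> = CARD('n option)"
    using assms(8) by (simp add: UNIV_option_conv card_image card_insert_if)
  obtain u where u: "u \<in> U' \<eta>" "v = affine_map Q d u" using assms(10,11) by blast
  have S_comp: "\<exists>A a B b. affine_map A a \<in> G \<and> affine_map B b \<in> G \<and>
      M ** N = matrix_inv P ** (Phi A a ** Phi B b) ** P \<and> N ** M = matrix_inv P ** (Phi B b ** Phi A a) ** P"
    if "M \<in> S" "N \<in> S" for M N
  proof -
    obtain A a B b where *: "affine_map A a \<in> G" "affine_map B b \<in> G"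
      "M = matrix_inv P ** Phi A a ** P" "N = matrix_inv P ** Phi B b ** P"
      using \<open>M \<in> S\<close> \<open>N \<in> S\<close> by (auto simp: S_def Phi_set_def)
    have "(matrix_inv P ** X ** P) ** (matrix_inv P ** Z ** P) = matrix_inv P ** (X ** Z) ** P" for X Z
    proof -
      have "(matrix_inv P ** X ** P) ** (matrix_inv P ** Z ** P) =
          matrix_inv P ** X ** (P ** matrix_inv P) ** Z ** P"
        by (simp only: matrix_mul_assoc)
      then show ?thesis by (simp add: P matrix_mul_assoc)
    qed
    with * show ?thesis by metis
  qed
  have comm: "M ** N = N ** M" if MN: "M \<in> S" "N \<in> S" for M N
  proof -
    obtain A a B b where *: "affine_map A a \<in> G" "affine_map B b \<in> G"
      "M ** N = matrix_inv P ** (Phi A a ** Phi B b) ** P" "N ** M = matrix_inv P ** (Phi B b ** Phi A a) ** P"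
      using S_comp[OF MN] by blast
    have "affine_map A a \<circ> affine_map B b = affine_map B b \<circ> affine_map A a"
      using assms(4) * by (auto simp: abelian_def)
    then have "Phi A a ** Phi B b = Phi B b ** Phi A a"
      by (simp add: affine_map_comp affine_map_inject Phi_mult)
    with * show ?thesis by simp
  qed
  have closed: "M ** N \<in> S" if MN: "M \<in> S" "N \<in> S" for M N
  proof -
    obtain A a B b where *: "affine_map A a \<in> G" "affine_map B b \<in> G"
      "M ** N = matrix_inv P ** (Phi A a ** Phi B b) ** P"
      using S_comp[OF MN] by blast
    have "affine_map A a \<circ> affine_map B b \<in> G"
      using * assms(3) by (auto intro: generated_semigroup.compose)
    then have "Phi A a ** Phi B b \<in> Phi_set G"
      unfolding Phi_set_def affine_map_comp Phi_mult by blast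
    with * show ?thesis by (auto simp: S_def)
  qed
  have G_MA: "g \<in> MA" if "g \<in> G" for g
    using that unfolding assms(3)
  proof induction
    case (compose g h)
    then obtain A a B b where "g = affine_map A a" "h = affine_map B b" by (auto simp: MA_def)
    then show ?case unfolding MA_def using affine_map_comp by blast
  qed (use assms(2) in auto)
  have "\<exists>M\<in>S. \<forall>x. M *v lift (q x) = lift (q (g x))" if "g \<in> G" for g
  proof -
    obtain A a where A: "g = affine_map A a" using G_MA[OF \<open>g \<in> G\<close>] by (auto simp: MA_def)
    have "matrix_inv P ** Phi A a ** P \<in> S" using \<open>g \<in> G\<close> A by (auto simp: S_def Phi_set_def)
    moreover have "(matrix_inv P ** Phi A a ** P) *v lift (q x) = lift (q (g x))" for x
      by (simp add: P_lift q Phi_mult_lift P_inv_lift A flip: matrix_vector_mul_assoc)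
    ultimately show ?thesis by blast
  qed
  \<comment> \<open>\<open>C g\<close> acts on the hyperplane as the conjugate of \<open>g\<close> by \<open>q\<close>.\<close>
  then obtain C where C: "\<And>g. g \<in> G \<Longrightarrow> C g \<in> S" "\<And>g x. g \<in> G \<Longrightarrow> C g *v lift (q x) = lift (q (g x))"
    by metis
  have lim_q: "(\<lambda>m. lift (q (xs m))) \<longlonglongrightarrow> lift (q x)" if "xs \<longlonglongrightarrow> x" for xs x
    using that continuous_affine_map unfolding q_affine
    by (intro tendsto_lift) (rule continuous_on_tendsto_compose[OF continuous_affine_map]; simp)
  have seqs: "\<exists>g xs. range g \<subseteq> G \<and> (\<lambda>m. lift (q (xs m))) \<longlonglongrightarrow> lift u \<and>
      (\<lambda>m. C (g m) *v lift (q (xs m))) \<longlonglongrightarrow> lift (q z)" for z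
  proof -
    have "z \<in> J_set p f v" using assms(12) by simp
    then obtain g xs where g: "range g \<subseteq> G" "xs \<longlonglongrightarrow> v" "(\<lambda>m. g m (xs m)) \<longlonglongrightarrow> z"
      using assms(3) by (metis J_set_sequences)
    then have "C (g m) *v lift (q (xs m)) = lift (q (g m (xs m)))" for m
      using C(2) by blast
    then show ?thesis
      using g(1) lim_q[OF g(2)] lim_q[OF g(3)] u(2) q(1)
      by (intro exI[of _ g] exI[of _ xs]) simp
  qed
  have span: "vec.span (insert (lift u) ((\<lambda>M. M *v lift u) ` S)) = UNIV"
  proof (rule cyclic_of_limits[of S "leader \<eta>", OF _ closed leader_le[OF \<eta>] leader_idem[OF \<eta>] _ span_lift])
    show "block_triangular (leader \<eta>) M" if "M \<in> S" for M
      using that assms(9) K_matrices_block_triangular[OF \<eta>] by (auto simp: S_def)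
    show "lift u $ leader \<eta> i \<noteq> 0" for i
      using lift_leader_nonzero[OF u(1) assms(7) \<eta>] .
    show "\<exists>x M. range M \<subseteq> S \<and> x \<longlonglongrightarrow> lift u \<and> (\<lambda>m. M m *v x m) \<longlonglongrightarrow> y"
      if y: "y \<in> range lift" for y
    proof -
      obtain z where z: "y = lift z" using y by blast
      obtain g xs where g: "range g \<subseteq> G" "(\<lambda>m. lift (q (xs m))) \<longlonglongrightarrow> lift u"
        "(\<lambda>m. C (g m) *v lift (q (xs m))) \<longlonglongrightarrow> y"
        using seqs[of "affine_map Q d z"] z q(1) by auto
      then show ?thesis
        using C(1) by (intro exI[of _ "\<lambda>m. lift (q (xs m))"] exI[of _ "\<lambda>m. C (g m)"]) auto
    qed
  qed
  have "z \<in> closure (orbit G v)" for z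
  proof -
    obtain g xs where g: "range g \<subseteq> G" "(\<lambda>m. lift (q (xs m))) \<longlonglongrightarrow> lift u"
      "(\<lambda>m. C (g m) *v lift (q (xs m))) \<longlonglongrightarrow> lift (q z)"
      using seqs by blast
    have gG: "g m \<in> G" for m using g(1) by blast
    have "(\<lambda>m. C (g m) *v lift u) \<longlonglongrightarrow> lift (q z)"
      using orbit_limit_of_cyclic[OF comm span _ g(2,3)] C(1)[OF gG] by blast
    moreover have "C (g m) *v lift u = lift (q (g m v))" for m
      using C(2)[OF gG, of m v] u(2) q(1) by simp
    ultimately have "(\<lambda>m. q (g m v)) \<longlonglongrightarrow> q z" using tendsto_liftD by simp
    then have "(\<lambda>m. affine_map Q d (q (g m v))) \<longlonglongrightarrow> affine_map Q d (q z)"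
      by (rule continuous_on_tendsto_compose[OF continuous_affine_map]) auto
    then have "(\<lambda>m. g m v) \<longlonglongrightarrow> z" by (simp add: q)
    moreover have "g m v \<in> orbit G v" for m using gG by (auto simp: orbit_def)
    ultimately show ?thesis
      unfolding closure_sequential by (intro exI[of _ "\<lambda>m. g m v"]) simp
  qed
  then show ?thesis by blast
qed

end
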